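(* Let $G$ be Clifford's totally ordered group, with order $\preceq$. Then a nontrivial final segment of $\{g\in G: g\succ 0\}$ (that is, a final segment which is neither empty nor the whole set $\{g\in G:g\succ 0\}$) cannot be a normal subset of $G$.
   Context: Clifford's group $G$ (written additively, nonabelian) is the group generated by symbols $g(\alpha)$, one for each rational number $\alpha$, subject to the relations $$g(\alpha)+g(\beta)=g\left(\tfrac{\alpha+\beta}{2}\right)+g(\alpha)\quad\text{if }\alpha>\beta.$$ Every nonzero element $a\in G$ can be written uniquely in normal form $a=m_1g(\alpha_1)+m_2g(\alpha_2)+\cdots+m_sg(\alpha_s)$, where the $m_i$ are nonzero integers and $\alpha_1<\alpha_2<\cdots<\alpha_s$ are rational numbers. $G$ is ordered by declaring $a\succ 0$ if $m_s>0$ (and $a\prec b$ iff $-a+b\succ 0$); this makes $G$ a totally ordered group (the order is total and preserved by left and right translations). These facts are due to Clifford. A subset $N$ of $G$ is normal if $-u+a+u\in N$ for all $a\in N$, $u\in G$. A final segment of an ordered set is a subset $F$ such that $x\in F$ and $x\preceq y$ imply $y\in F$. *)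

theory Defs
  imports Complex_Main
begin

section \<open>Clifford's group by generators and relations\<close>

text \<open>A word is a list of signed letters: (True, a) stands for the generator g(a), and
  (False, a) for -g(a). The group is the set of words modulo the least congruence that cancels
  inverse pairs and contains the defining relations.\<close>

type_synonym word = "(bool \<times> rat) list"

inductive clifford_eq :: "word \<Rightarrow> word \<Rightarrow> bool" where
  refl: "clifford_eq u u"
| sym: "clifford_eq u v \<Longrightarrow> clifford_eq v u"
| trans: "clifford_eq u v \<Longrightarrow> clifford_eq v w \<Longrightarrow> clifford_eq u w"
| app: "clifford_eq u v \<Longrightarrow> clifford_eq u' v' \<Longrightarrow> clifford_eq (u @ u') (v @ v')"
| cancel: "clifford_eq [(s, a), (\<not> s, a)] []"
| relation: "a > b \<Longrightarrow> clifford_eq [(True, a), (True, b)] [(True, (a + b) / 2), (True, a)]"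

quotient_type clifford = word / clifford_eq
  by (intro equivpI reflpI sympI transpI) (blast intro: clifford_eq.intros)+

definition inv_word :: "word \<Rightarrow> word" where
  "inv_word w = rev (map (\<lambda>(s, a). (\<not> s, a)) w)"

lemma inv_word_simps:
  "inv_word [] = []" "inv_word (p # w) = inv_word w @ [(\<not> fst p, snd p)]"
  "inv_word (u @ v) = inv_word v @ inv_word u" "inv_word (inv_word w) = w"
  by (auto simp: inv_word_def rev_map o_def case_prod_beta)

lemma clifford_eq_inv_left: "clifford_eq (inv_word w @ w) []"
proof (induction w)
  case Nil
  then show ?case by (simp add: inv_word_simps clifford_eq.refl)
next
  case (Cons p w)
  have "clifford_eq [(\<not> fst p, snd p), p] []"
    using clifford_eq.cancel[of "\<not> fst p" "snd p"] by simp
  then have "clifford_eq ([(\<not> fst p, snd p), p] @ w) ([] @ w)"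
    by (rule clifford_eq.app[OF _ clifford_eq.refl])
  then have "clifford_eq (inv_word w @ ([(\<not> fst p, snd p), p] @ w)) (inv_word w @ ([] @ w))"
    by (rule clifford_eq.app[OF clifford_eq.refl])
  then show ?case using Cons by (auto simp: inv_word_simps intro: clifford_eq.trans)
qed

lemma clifford_eq_inv_right: "clifford_eq (w @ inv_word w) []"
  using clifford_eq_inv_left[of "inv_word w"] by (simp add: inv_word_simps)

lemma clifford_eq_inv: "clifford_eq (inv_word u) (inv_word v)" if "clifford_eq u v"
proof -
  have "clifford_eq (inv_word u @ (v @ inv_word v)) (inv_word u @ [])"
    by (intro clifford_eq.app clifford_eq.refl clifford_eq_inv_right)
  moreover have "clifford_eq ((inv_word u @ v) @ inv_word v) ([] @ inv_word v)"
    using that clifford_eq_inv_left[of u]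
    by (meson clifford_eq.app clifford_eq.refl clifford_eq.sym clifford_eq.trans)
  ultimately show ?thesis by (metis append.assoc append_Nil append_Nil2 clifford_eq.sym clifford_eq.trans)
qed

instantiation clifford :: group_add
begin

lift_definition zero_clifford :: clifford is "[]" .
lift_definition plus_clifford :: "clifford \<Rightarrow> clifford \<Rightarrow> clifford" is "(@)"
  by (rule clifford_eq.app)
lift_definition uminus_clifford :: "clifford \<Rightarrow> clifford" is inv_word
  by (rule clifford_eq_inv)
definition minus_clifford :: "clifford \<Rightarrow> clifford \<Rightarrow> clifford" where
  "minus_clifford a b = a + (- b)"

instance
proof
  fix a b c :: clifford
  show "a + b + c = a + (b + c)" by transfer (simp add: clifford_eq.refl)
  show "0 + a = a" by transfer (simp add: clifford_eq.refl)
  show "a + 0 = a" by transfer (simp add: clifford_eq.refl)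
  show "- a + a = 0" by transfer (rule clifford_eq_inv_left)
  show "a + (- b) = a - b" by (simp add: minus_clifford_def)
qed

end

lift_definition gen :: "rat \<Rightarrow> clifford" is "\<lambda>a. [(True, a)]" .

lemma gen_relation: "gen a + gen b = gen ((a + b) / 2) + gen a" if "a > b"
  using that by transfer (simp add: clifford_eq.relation)


section \<open>Normal forms and the order\<close>

definition int_mult :: "int \<Rightarrow> 'a::group_add \<Rightarrow> 'a" where
  "int_mult m a = (if 0 \<le> m then sum_list (replicate (nat m) a)
                   else sum_list (replicate (nat (- m)) (- a)))"

definition nf_value :: "(int \<times> rat) list \<Rightarrow> clifford" where
  "nf_value xs = (\<Sum>(m, a)\<leftarrow>xs. int_mult m (gen a))"

text \<open>The empty list is the normal form of 0.\<close>

definition normal_form :: "(int \<times> rat) list \<Rightarrow> bool" where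
  "normal_form xs \<longleftrightarrow> (\<forall>(m, a) \<in> set xs. m \<noteq> 0) \<and> sorted_wrt (<) (map snd xs)"

definition positive :: "clifford \<Rightarrow> bool" where
  "positive a \<longleftrightarrow> (\<exists>xs. xs \<noteq> [] \<and> normal_form xs \<and> nf_value xs = a \<and> fst (last xs) > 0)"


subsection \<open>Existence and uniqueness of normal forms\<close>

declare add_uminus_conv_diff [simp del]

lemmas group_norm = add.assoc minus_add diff_conv_add_uminus

lemma int_mult_succ: "int_mult (m + 1) a = a + int_mult m a"
proof (cases "0 \<le> m")
  case True
  then show ?thesis by (simp add: int_mult_def nat_add_distrib)
next
  case False
  then obtain k where m: "m = - int (Suc k)"
    by (metis int_cases of_nat_0_le_iff)
  have "nat (- m) = Suc k" "\<not> 0 \<le> m" by (simp_all add: m)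
  then have "int_mult m a = - a + sum_list (replicate k (- a))"
    by (simp only: int_mult_def if_False replicate_Suc sum_list.Cons)
  moreover have "int_mult (m + 1) a = sum_list (replicate k (- a))"
  proof (cases k)
    case 0
    then show ?thesis by (simp add: int_mult_def m)
  next
    case (Suc j)
    have "nat (- (m + 1)) = k" "\<not> 0 \<le> m + 1" by (simp_all add: m Suc)
    then show ?thesis by (simp only: int_mult_def if_False)
  qed
  ultimately show ?thesis by simp
qed

lemma int_mult_0 [simp]: "int_mult 0 a = 0"
  by (simp add: int_mult_def)

lemma int_mult_pred: "int_mult (m - 1) a = - a + int_mult m a"
  using int_mult_succ[of "m - 1" a] by (simp add: add.assoc[symmetric])

lemma int_mult_conj: "c + int_mult m a + - c = int_mult m (c + a + - c)"
proof (induction m rule: int_induct[where k = 0])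
  case (step1 m)
  then show ?case unfolding int_mult_succ step1(2)[symmetric] by (simp add: group_norm)
next
  case (step2 m)
  then show ?case unfolding int_mult_pred step2(2)[symmetric]
    by (simp add: group_norm)
qed simp

lemma nf_value_simps [simp]:
  "nf_value [] = 0" "nf_value (p # xs) = int_mult (fst p) (gen (snd p)) + nf_value xs"
  "nf_value (xs @ ys) = nf_value xs + nf_value ys"
  by (auto simp: nf_value_def case_prod_beta add.assoc)

lemma conj_gen_up: "gen a + gen b + - gen a = gen ((a + b) / 2)" if "b < a"
  using gen_relation[OF that] by (metis add.assoc add.right_neutral right_minus)

lemma conj_gen_down: "- gen a + gen b + gen a = gen (2 * b - a)" if "b < a"
proof -
  have "gen a + gen (2 * b - a) = gen b + gen a"
    using gen_relation[of "2 * b - a" a] that by simp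
  then show ?thesis by (metis add.assoc add.left_neutral left_minus)
qed

lemma nf_value_up:
  "gen a + nf_value xs = nf_value (map (\<lambda>(m, b). (m, (a + b) / 2)) xs) + gen a"
  if "\<forall>p \<in> set xs. snd p < a"
  using that
proof (induction xs)
  case (Cons p xs)
  have "gen a + int_mult (fst p) (gen (snd p)) + - gen a = int_mult (fst p) (gen ((a + snd p) / 2))"
    using Cons.prems by (simp add: int_mult_conj conj_gen_up)
  then have "gen a + int_mult (fst p) (gen (snd p)) = int_mult (fst p) (gen ((a + snd p) / 2)) + gen a"
    by (metis add.assoc add.right_neutral left_minus)
  then have "gen a + nf_value (p # xs)
      = int_mult (fst p) (gen ((a + snd p) / 2)) + (gen a + nf_value xs)"
    by (simp add: add.assoc[symmetric])
  then show ?case using Cons by (simp add: add.assoc case_prod_beta)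
qed simp

lemma nf_value_down:
  "- gen a + nf_value xs = nf_value (map (\<lambda>(m, b). (m, 2 * b - a)) xs) + - gen a"
  if "\<forall>p \<in> set xs. snd p < a"
proof -
  define ys where "ys = map (\<lambda>(m, b). (m, 2 * b - a)) xs"
  have "map (\<lambda>(m, b). (m, (a + b) / 2)) ys = xs"
    unfolding ys_def by (simp add: o_def case_prod_beta)
  moreover have "\<forall>p \<in> set ys. snd p < a"
    using that by (auto simp: ys_def)
  ultimately have "gen a + nf_value ys = nf_value xs + gen a"
    using nf_value_up[of ys a] by simp
  then show ?thesis
    unfolding ys_def[symmetric] by (metis add.assoc add.left_neutral add.right_neutral left_minus right_minus)
qed

lemma normal_form_Nil: "normal_form []"
  by (simp add: normal_form_def)

lemma normal_form_Cons:
  "normal_form (p # xs) \<longleftrightarrow> fst p \<noteq> 0 \<and> (\<forall>q \<in> set xs. snd p < snd q) \<and> normal_form xs"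
  by (auto simp: normal_form_def case_prod_beta)

lemma normal_form_append:
  "normal_form (xs @ ys) \<longleftrightarrow>
     normal_form xs \<and> normal_form ys \<and> (\<forall>p \<in> set xs. \<forall>q \<in> set ys. snd p < snd q)"
  by (auto simp: normal_form_def sorted_wrt_append)

lemma normal_form_map:
  "normal_form (map (\<lambda>(m, b). (m, h b)) xs)" if "normal_form xs" "\<And>x y. x < y \<Longrightarrow> h x < h y"
  using that(1) by (induction xs) (auto simp: normal_form_Cons normal_form_Nil that(2) case_prod_beta)

lemma normal_form_split:
  assumes "normal_form xs"
  obtains lo m hi where "nf_value xs = nf_value lo + int_mult m (gen a) + nf_value hi"
    "normal_form lo" "normal_form hi" "\<forall>p \<in> set lo. snd p < a" "\<forall>p \<in> set hi. a < snd p"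
  using assms
proof (induction xs arbitrary: thesis)
  case Nil
  show ?case by (rule Nil(1)[of "[]" 0 "[]"]) (auto simp: normal_form_Nil)
next
  case (Cons p xs)
  consider "snd p < a" | "snd p = a" | "a < snd p" by fastforce
  then show ?case
  proof cases
    case 1
    have "normal_form xs" using Cons.prems by (simp add: normal_form_Cons)
    define lo where "lo = takeWhile (\<lambda>q. snd q < a) xs"
    define re where "re = dropWhile (\<lambda>q. snd q < a) xs"
    have xs: "xs = lo @ re" by (simp add: lo_def re_def)
    have lo: "\<forall>q \<in> set lo. snd q < a" unfolding lo_def by (meson set_takeWhileD)
    have nf: "normal_form lo" "normal_form re" "normal_form (p # lo)"
      using Cons.prems by (auto simp: xs normal_form_Cons normal_form_append)
    show ?thesis
    proof (cases re)
      case Nil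
      show ?thesis by (rule Cons(2)[of "p # lo" 0 "[]"]) (use 1 lo nf Nil xs in \<open>auto simp: normal_form_Nil\<close>)
    next
      case (Cons q hi)
      have q: "\<not> snd q < a" using hd_dropWhile[of "\<lambda>q. snd q < a" xs] Cons unfolding re_def by simp
      show ?thesis
      proof (cases "snd q = a")
        case True
        show ?thesis
          by (rule Cons.prems(1)[of "p # lo" "fst q" hi])
            (use 1 lo nf Cons xs True in \<open>auto simp: normal_form_Cons add.assoc\<close>)
      next
        case False
        have hi: "\<forall>r \<in> set re. a < snd r"
        proof
          fix r assume "r \<in> set re"
          then have "snd q \<le> snd r" using nf(2) Cons by (auto simp: normal_form_Cons)
          then show "a < snd r" using q False by simp
        qed
        show ?thesis
          by (rule Cons.prems(1)[of "p # lo" 0 re]) (use 1 lo nf xs hi in \<open>auto simp: add.assoc\<close>)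
      qed
    qed
  next
    case 2
    show ?thesis
      by (rule Cons.prems(1)[of "[]" "fst p" xs])
        (use 2 Cons.prems in \<open>auto simp: normal_form_Cons normal_form_Nil\<close>)
  next
    case 3
    have hi: "\<forall>r \<in> set (p # xs). a < snd r"
      using 3 Cons.prems(2) by (fastforce simp: normal_form_Cons)
    show ?thesis
      by (rule Cons.prems(1)[of "[]" 0 "p # xs"]) (use hi Cons.prems(2) in \<open>auto simp: normal_form_Nil\<close>)
  qed
qed

lemma normal_form_join:
  assumes "normal_form lo" "normal_form hi" "\<forall>p \<in> set lo. snd p < a" "\<forall>p \<in> set hi. a < snd p"
  shows "\<exists>xs. normal_form xs \<and> nf_value xs = nf_value lo + int_mult m (gen a) + nf_value hi"
proof (cases "m = 0")
  case True
  have lt: "snd p < snd q" if "p \<in> set lo" "q \<in> set hi" for p q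
    using assms(3,4) that by (meson less_trans)
  show ?thesis by (rule exI[of _ "lo @ hi"])
      (use assms True lt in \<open>auto simp: normal_form_append\<close>)
next
  case False
  have lt: "snd p < snd q" if "p \<in> set lo" "q \<in> set hi" for p q
    using assms(3,4) that by (meson less_trans)
  show ?thesis by (rule exI[of _ "lo @ (m, a) # hi"])
      (use assms False lt in \<open>auto simp: normal_form_append normal_form_Cons add.assoc\<close>)
qed

lemma normal_form_gen_add:
  assumes "normal_form xs"
  shows "\<exists>ys. normal_form ys \<and> nf_value ys = gen a + nf_value xs"
    and "\<exists>ys. normal_form ys \<and> nf_value ys = - gen a + nf_value xs"
proof -
  obtain lo m hi where s: "nf_value xs = nf_value lo + int_mult m (gen a) + nf_value hi"
    "normal_form lo" "normal_form hi" "\<forall>p \<in> set lo. snd p < a" "\<forall>p \<in> set hi. a < snd p"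
    using normal_form_split[OF assms, of a] .
  have "\<exists>ys. normal_form ys \<and> nf_value ys =
      nf_value (map (\<lambda>(m, b). (m, (a + b) / 2)) lo) + int_mult (m + 1) (gen a) + nf_value hi"
    by (rule normal_form_join) (use s in \<open>auto intro!: normal_form_map\<close>)
  then show "\<exists>ys. normal_form ys \<and> nf_value ys = gen a + nf_value xs"
    by (simp add: s(1) int_mult_succ add.assoc[symmetric] nf_value_up[OF s(4)])
  have "\<exists>ys. normal_form ys \<and> nf_value ys =
      nf_value (map (\<lambda>(m, b). (m, 2 * b - a)) lo) + int_mult (m - 1) (gen a) + nf_value hi"
    by (rule normal_form_join) (use s in \<open>auto intro!: normal_form_map\<close>)
  moreover have "- gen a + nf_value xs =
      nf_value (map (\<lambda>(m, b). (m, 2 * b - a)) lo) + int_mult (m - 1) (gen a) + nf_value hi"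
    unfolding s(1) int_mult_pred add.assoc[symmetric] nf_value_down[OF s(4)] ..
  ultimately show "\<exists>ys. normal_form ys \<and> nf_value ys = - gen a + nf_value xs"
    by simp
qed

lemma clifford_induct [case_names zero gen neg_gen]:
  assumes "P 0" "\<And>a x. P x \<Longrightarrow> P (gen a + x)" "\<And>a x. P x \<Longrightarrow> P (- gen a + x)"
  shows "P x"
proof -
  have "P (abs_clifford w)" for w
  proof (induction w)
    case Nil
    then show ?case using assms(1) by (simp add: zero_clifford_def)
  next
    case (Cons p w)
    have "abs_clifford (p # w) = (if fst p then gen (snd p) else - gen (snd p)) + abs_clifford w"
      by (cases p) (simp add: gen_def uminus_clifford.abs_eq plus_clifford.abs_eq inv_word_simps)
    then show ?case using assms(2,3) Cons by simp
  qed
  then show ?thesis by (cases x) (metis Quotient3_abs_rep Quotient3_clifford)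
qed

lemma normal_form_exists: "\<exists>xs. normal_form xs \<and> nf_value xs = x"
proof (induction x rule: clifford_induct)
  case zero
  show ?case using normal_form_Nil by force
qed (use normal_form_gen_add in blast)+

text \<open>Uniqueness follows from an action of the group on functions from the rationals to the integers:
  the element with normal form coefficients f sends the zero function to f.\<close>

fun act_letter :: "bool \<times> rat \<Rightarrow> (rat \<Rightarrow> int) \<Rightarrow> rat \<Rightarrow> int" where
  "act_letter (True, a) f = (\<lambda>x. if x < a then f (2 * x - a) else if x = a then f a + 1 else f x)"
| "act_letter (False, a) f = (\<lambda>x. if x < a then f ((a + x) / 2) else if x = a then f a - 1 else f x)"

lift_definition act :: "clifford \<Rightarrow> (rat \<Rightarrow> int) \<Rightarrow> rat \<Rightarrow> int" is "\<lambda>w. foldr act_letter w"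
proof -
  fix u v :: word
  assume "clifford_eq u v"
  then show "foldr act_letter u = foldr act_letter v"
  proof induction
    case (cancel s a)
    have half: "(2 * a + 2 * x) / 2 = a + x" for x :: rat by (simp add: field_simps)
    show ?case by (cases s) (auto simp: fun_eq_iff half)
  next
    case (relation a b)
    have half: "(x * 8 - (u * 2 + v * 4)) / 2 = x * 4 - (u + v * 2)" for x u v :: rat
      by (simp add: field_simps)
    show ?case using relation by (auto simp: fun_eq_iff field_simps half)
  qed auto
qed

lemma act_0 [simp]: "act 0 f = f"
  by transfer simp

lemma act_add [simp]: "act (a + b) f = act a (act b f)"
  by transfer simp

lemma act_gen: "act (gen a) f = act_letter (True, a) f"
  by transfer simp

lemma act_minus_gen: "act (- gen a) f = act_letter (False, a) f"
  by transfer (simp add: inv_word_simps)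

lemma act_int_mult:
  "(x > a \<longrightarrow> act (int_mult m (gen a)) f x = f x) \<and> act (int_mult m (gen a)) f a = f a + m \<and>
   ((\<forall>y<a. f y = 0) \<longrightarrow> (\<forall>y<a. act (int_mult m (gen a)) f y = 0))"
proof (induction m rule: int_induct[where k = 0])
  case (step1 m)
  then show ?case by (auto simp: int_mult_succ act_gen)
next
  case (step2 m)
  then show ?case by (auto simp: int_mult_pred act_minus_gen)
qed simp

lemma act_nf_above: "(\<forall>p \<in> set xs. snd p < x) \<Longrightarrow> act (nf_value xs) f x = f x"
  by (induction xs) (auto simp: act_int_mult)

lemma act_nf_top:
  "(\<forall>p \<in> set xs. snd p \<le> t) \<Longrightarrow> act (nf_value xs) f t = f t + act (nf_value xs) (\<lambda>_. 0) t"
proof (induction xs)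
  case (Cons p xs)
  then show ?case by (cases "snd p = t") (auto simp: act_int_mult)
qed simp

definition coeff :: "clifford \<Rightarrow> rat \<Rightarrow> int" where
  "coeff a = act a (\<lambda>_. 0)"

lemma coeff_nf:
  assumes "normal_form xs"
  shows "(m, a) \<in> set xs \<Longrightarrow> coeff (nf_value xs) a = m"
    and "a \<notin> snd ` set xs \<Longrightarrow> coeff (nf_value xs) a = 0"
proof -
  have "((m, a) \<in> set xs \<longrightarrow> coeff (nf_value xs) a = m) \<and>
        (a \<notin> snd ` set xs \<longrightarrow> coeff (nf_value xs) a = 0)" for m a
    using assms
  proof (induction xs arbitrary: m a)
    case Nil
    then show ?case by (simp add: coeff_def)
  next
    case (Cons p xs)
    let ?f = "coeff (nf_value xs)"
    have IH: "((m, b) \<in> set xs \<longrightarrow> ?f b = m) \<and> (b \<notin> snd ` set xs \<longrightarrow> ?f b = 0)" for m b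
      using Cons by (simp add: normal_form_Cons)
    have gt: "snd p < snd q" if "q \<in> set xs" for q
      using Cons.prems that by (simp add: normal_form_Cons)
    have z: "?f y = 0" if "y \<le> snd p" for y
      using IH[of _ y] gt that by force
    have eq: "coeff (nf_value (p # xs)) = act (int_mult (fst p) (gen (snd p))) ?f"
      by (simp add: coeff_def)
    consider "a < snd p" | "a = snd p" | "a > snd p" by fastforce
    then show ?case
    proof cases
      case 1
      then have "coeff (nf_value (p # xs)) a = 0"
        unfolding eq using act_int_mult[of "snd p" _ "fst p" ?f] z by simp
      moreover have "(m, a) \<notin> set (p # xs)"
        using gt[of "(m, a)"] 1 by auto
      ultimately show ?thesis by blast
    next
      case 2
      then have "coeff (nf_value (p # xs)) a = fst p"
        unfolding eq using act_int_mult[of "snd p" _ "fst p" ?f] z by simp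
      moreover have "m = fst p" if "(m, a) \<in> set (p # xs)"
        using that gt[of "(m, a)"] 2 by (cases p) auto
      moreover have "a \<in> snd ` set (p # xs)" using 2 by simp
      ultimately show ?thesis by blast
    next
      case 3
      then have "coeff (nf_value (p # xs)) a = ?f a"
        unfolding eq using act_int_mult[of "snd p" a "fst p" ?f] by simp
      moreover have "(m, a) \<in> set (p # xs) \<longleftrightarrow> (m, a) \<in> set xs"
        "a \<in> snd ` set (p # xs) \<longleftrightarrow> a \<in> snd ` set xs" using 3 by auto
      ultimately show ?thesis using IH[of m a] by simp
    qed
  qed
  then show "(m, a) \<in> set xs \<Longrightarrow> coeff (nf_value xs) a = m"
    and "a \<notin> snd ` set xs \<Longrightarrow> coeff (nf_value xs) a = 0" by blast+
qed

lemma normal_form_set: "set xs = {(m, a). m \<noteq> 0 \<and> coeff (nf_value xs) a = m}" if "normal_form xs"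
  using coeff_nf[OF that] that by (force simp: normal_form_def)

theorem normal_form_unique: "xs = ys"
  if "normal_form xs" "normal_form ys" "nf_value xs = nf_value ys"
proof -
  have "set xs = set ys"
    using normal_form_set[OF that(1)] normal_form_set[OF that(2)] that(3) by simp
  moreover from this have "map snd xs = map snd ys"
    using that(1,2) by (intro strict_sorted_equal) (auto simp: normal_form_def)
  moreover have "inj_on snd (set ys)"
    using that(2) by (metis distinct_map normal_form_def strict_sorted_iff)
  ultimately show ?thesis by (metis inj_on_map_eq_map sup.idem)
qed

theorem normal_form_ex1: "\<exists>!xs. normal_form xs \<and> nf_value xs = a"
  using normal_form_exists normal_form_unique by blast


subsection \<open>The total order\<close>

lemma coeff_add:
  assumes "\<forall>x>t. coeff a x = 0"
  shows "x > t \<Longrightarrow> coeff (a + b) x = coeff b x" "coeff (a + b) t = coeff a t + coeff b t"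
proof -
  obtain xs where xs: "normal_form xs" "nf_value xs = a" using normal_form_exists by blast
  have le: "\<forall>p \<in> set xs. snd p \<le> t"
    using assms normal_form_set[OF xs(1)] xs(2) by (auto simp: not_less[symmetric])
  show "x > t \<Longrightarrow> coeff (a + b) x = coeff b x"
    using le act_nf_above[of xs x] xs(2) by (fastforce simp: coeff_def)
  show "coeff (a + b) t = coeff a t + coeff b t"
    using act_nf_top[OF le, of "act b (\<lambda>_. 0)"] by (simp add: coeff_def xs(2))
qed

lemma normal_form_le_last: "snd p \<le> snd (last xs)" if "normal_form xs" "p \<in> set xs"
  using that by (induction xs) (auto simp: normal_form_Cons intro: less_imp_le)

lemma coeff_last:
  assumes "normal_form xs" "xs \<noteq> []"
  shows "coeff (nf_value xs) (snd (last xs)) = fst (last xs)"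
    and "x > snd (last xs) \<Longrightarrow> coeff (nf_value xs) x = 0"
proof -
  show "coeff (nf_value xs) (snd (last xs)) = fst (last xs)"
    using assms by (intro coeff_nf) auto
  show "x > snd (last xs) \<Longrightarrow> coeff (nf_value xs) x = 0"
    using assms(1) normal_form_le_last[OF assms(1)] by (intro coeff_nf(2)) (auto simp: not_less[symmetric])
qed

lemma positive_iff_coeff: "positive a \<longleftrightarrow> (\<exists>t. coeff a t > 0 \<and> (\<forall>x>t. coeff a x = 0))"
proof
  assume "positive a"
  then show "\<exists>t. coeff a t > 0 \<and> (\<forall>x>t. coeff a x = 0)"
    using coeff_last unfolding positive_def by metis
next
  assume "\<exists>t. coeff a t > 0 \<and> (\<forall>x>t. coeff a x = 0)"
  then obtain t where t: "coeff a t > 0" "\<forall>x>t. coeff a x = 0" by blast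
  obtain xs where xs: "normal_form xs" "nf_value xs = a" using normal_form_exists by blast
  have "xs \<noteq> []" using xs t by (auto simp: coeff_def)
  note l = coeff_last[OF xs(1) this, unfolded xs(2)]
  have "fst (last xs) \<noteq> 0"
    using xs(1) \<open>xs \<noteq> []\<close> last_in_set[of xs] by (auto simp: normal_form_def case_prod_beta)
  then have "snd (last xs) = t" using l t by (metis less_irrefl linorder_neqE)
  then show "positive a" using xs l t \<open>xs \<noteq> []\<close> by (auto simp: positive_def)
qed

lemma not_positive_0: "\<not> positive 0"
  by (simp add: positive_iff_coeff coeff_def)

lemma positive_add: "positive (a + b)" if "positive a" "positive b"
proof -
  obtain t s where t: "coeff a t > 0" "\<forall>x>t. coeff a x = 0" and s: "coeff b s > 0" "\<forall>x>s. coeff b x = 0"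
    using \<open>positive a\<close> \<open>positive b\<close> by (auto simp: positive_iff_coeff)
  note ab = coeff_add[OF t(2), where b = b]
  consider "t < s" | "t = s" | "s < t" by fastforce
  then show ?thesis
    unfolding positive_iff_coeff
  proof cases
    case 1
    then show "\<exists>t. coeff (a + b) t > 0 \<and> (\<forall>x>t. coeff (a + b) x = 0)"
      using ab(1) s by (intro exI[of _ s]) auto
  next
    case 2
    then show "\<exists>t. coeff (a + b) t > 0 \<and> (\<forall>x>t. coeff (a + b) x = 0)"
      using ab t s by (intro exI[of _ t]) auto
  next
    case 3
    then show "\<exists>t. coeff (a + b) t > 0 \<and> (\<forall>x>t. coeff (a + b) x = 0)"
      using ab t s by (intro exI[of _ t]) auto
  qed
qed

lemma positive_total: "a = 0 \<or> positive a \<or> positive (- a)"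
proof -
  obtain xs where xs: "normal_form xs" "nf_value xs = a" using normal_form_exists by blast
  show ?thesis
  proof (cases "xs = []")
    case True
    then show ?thesis using xs by simp
  next
    case False
    let ?t = "snd (last xs)"
    note l = coeff_last[OF xs(1) False, unfolded xs(2)]
    have nz: "fst (last xs) \<noteq> 0"
      using xs(1) False last_in_set[of xs] by (auto simp: normal_form_def case_prod_beta)
    have "\<forall>x > ?t. coeff (- a) x = 0" "coeff a ?t + coeff (- a) ?t = 0"
      using coeff_add[of ?t a, where b = "- a"] l(2) by (auto simp: coeff_def)
    then have "positive (- a)" if "fst (last xs) < 0"
      unfolding positive_iff_coeff using l(1) that by (intro exI[of _ ?t]) auto
    moreover have "positive a" if "fst (last xs) > 0"
      unfolding positive_def using xs False that by blast
    ultimately show ?thesis using nz by linarith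
  qed
qed

instantiation clifford :: linorder
begin

definition less_clifford :: "clifford \<Rightarrow> clifford \<Rightarrow> bool" where
  "a < b \<longleftrightarrow> positive (- a + b)"

definition less_eq_clifford :: "clifford \<Rightarrow> clifford \<Rightarrow> bool" where
  "a \<le> b \<longleftrightarrow> a = b \<or> a < (b::clifford)"

instance
proof
  fix a b c :: clifford
  have tr: "a < c" if "a < b" "b < c" for a b c :: clifford
    using positive_add[OF that[unfolded less_clifford_def]]
    by (simp add: less_clifford_def add.assoc[symmetric]) (simp add: add.assoc)
  have irr: "\<not> a < a" for a :: clifford
    by (simp add: less_clifford_def not_positive_0)
  show "a < b \<longleftrightarrow> a \<le> b \<and> \<not> b \<le> a" using tr irr unfolding less_eq_clifford_def by metis
  show "a \<le> a" by (simp add: less_eq_clifford_def)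
  show "a \<le> c" if "a \<le> b" "b \<le> c" using that tr unfolding less_eq_clifford_def by metis
  show "a = b" if "a \<le> b" "b \<le> a" using that tr irr unfolding less_eq_clifford_def by metis
  have "- (- a + b) = - b + a" by (simp add: minus_add)
  then show "a \<le> b \<or> b \<le> a"
    using positive_total[of "- a + b"]
    by (auto simp: less_eq_clifford_def less_clifford_def) (metis add.right_neutral add_minus_cancel)
qed

end

lemma zero_less_clifford_iff: "0 < a \<longleftrightarrow> positive a"
  by (simp add: less_clifford_def)

theorem clifford_add_left_mono: "c + a < c + b \<longleftrightarrow> a < (b::clifford)"
  by (simp add: less_clifford_def group_norm)

lemma positive_conj_gen: "positive (gen a + x + - gen a)" "positive (- gen a + x + gen a)"
  if pos: "positive x"
proof -
  obtain xs where xs: "xs \<noteq> []" "normal_form xs" "nf_value xs = x" "fst (last xs) > 0"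
    using pos by (auto simp: positive_def)
  have "positive (gen a + x + - gen a) \<and> positive (- gen a + x + gen a)"
  proof (cases "snd (last xs) < a")
    case True
    have "\<forall>p \<in> set xs. snd p < a"
      using normal_form_le_last[OF xs(2)] True by fastforce
    note lt = this
    let ?u = "map (\<lambda>(m, b). (m, (a + b) / 2)) xs" and ?d = "map (\<lambda>(m, b). (m, 2 * b - a)) xs"
    have "nf_value ?u = gen a + x + - gen a" "nf_value ?d = - gen a + x + gen a"
      using nf_value_up[OF lt] nf_value_down[OF lt] xs(3) by (simp_all add: add.assoc)
    moreover have "normal_form ?u" "normal_form ?d"
      using xs(2) by (auto intro!: normal_form_map)
    moreover have "fst (last ?u) > 0" "fst (last ?d) > 0"
      using xs by (auto simp: last_map case_prod_beta)
    ultimately show ?thesis using xs(1) unfolding positive_def by (metis map_is_Nil_conv)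
  next
    case False
    define t where "t = snd (last xs)"
    have x: "coeff x t > 0" "\<forall>y>t. coeff x y = 0"
      using coeff_last[OF xs(2,1)] xs by (auto simp: t_def)
    have g: "\<forall>y>t. coeff (gen a) y = 0" "\<forall>y>t. coeff (- gen a) y = 0"
      "coeff (gen a) t + coeff (- gen a) t = 0"
      using False by (auto simp: coeff_def act_gen act_minus_gen t_def)
    have "coeff (gen a + (x + - gen a)) t = coeff x t" "coeff (- gen a + (x + gen a)) t = coeff x t"
      "\<forall>y>t. coeff (gen a + (x + - gen a)) y = 0" "\<forall>y>t. coeff (- gen a + (x + gen a)) y = 0"
      using g coeff_add[OF g(1)] coeff_add[OF g(2)] coeff_add[OF x(2)] by auto
    then have "positive (gen a + (x + - gen a))" "positive (- gen a + (x + gen a))"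
      using x(1) unfolding positive_iff_coeff by (auto intro!: exI[of _ t])
    then show ?thesis by (simp add: add.assoc)
  qed
  then show "positive (gen a + x + - gen a)" "positive (- gen a + x + gen a)" by auto
qed

lemma positive_conj: "positive x \<Longrightarrow> positive (- u + x + u)"
proof (induction u arbitrary: x rule: clifford_induct)
  case (gen a u)
  have "positive (- u + (- gen a + x + gen a) + u)" by (intro gen positive_conj_gen)
  then show ?case by (simp add: group_norm)
next
  case (neg_gen a u)
  have "positive (- u + (gen a + x + - gen a) + u)" by (intro neg_gen positive_conj_gen)
  then show ?case by (simp add: group_norm)
qed simp

theorem clifford_add_right_mono: "a + c < b + c \<longleftrightarrow> a < (b::clifford)"
proof -
  have *: "a + c < b + c" if "a < b" for a b c :: clifford
    using positive_conj[of "- a + b" c] that by (simp add: less_clifford_def group_norm)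
  show ?thesis using *[of a b c] *[of "a + c" "b + c" "- c"] by (auto simp: add.assoc)
qed

declare add_uminus_conv_diff [simp]


section \<open>Normal subsets and final segments\<close>

definition normal_subset :: "'a::group_add set \<Rightarrow> bool" where
  "normal_subset N \<longleftrightarrow> (\<forall>a \<in> N. \<forall>u. - u + a + u \<in> N)"

definition final_segment :: "'a::order set \<Rightarrow> 'a set \<Rightarrow> bool" where
  "final_segment A F \<longleftrightarrow> F \<subseteq> A \<and> (\<forall>x \<in> F. \<forall>y \<in> A. x \<le> y \<longrightarrow> y \<in> F)"

end

theory Submission
  imports Defs
begin

text \<open>If \<open>c\<close> exceeds every index \<open>b\<close> in the normal form of \<open>a\<close>, then passing to \<open>- gen c + a + gen c\<close>
  keeps the coefficients and moves each index \<open>b\<close> to \<open>2 * b - c\<close>. As \<open>c\<close> grows, all indices go to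
  minus infinity. The sign of an element is decided by its coefficient of largest index, so
  every positive element, however large, has conjugates below any given positive element
  (\<open>conjugate_below_positive\<close>). A normal final segment that contains one positive element
  therefore contains all of them.\<close>

lemma conjugate_coeff_eventually_zero:
  "\<exists>u. \<forall>x\<ge>s. coeff (- u + a + u) x = 0"
proof -
  obtain xs where xs: "normal_form xs" "nf_value xs = a"
    using normal_form_exists by blast
  \<comment> \<open>The two bounds on \<open>c\<close> say that it exceeds the top index \<open>t\<close> of \<open>xs\<close> and that \<open>2 * t - c < s\<close>.\<close>
  define c where "c = max (snd (last xs)) (2 * snd (last xs) - s) + 1"
  have c: "snd p < c" "2 * snd p - c < s" if "p \<in> set xs" for p
    using normal_form_le_last[OF xs(1) that] by (auto simp: c_def max_def)
  define ys where "ys = map (\<lambda>(m, b). (m, 2 * b - c)) xs"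
  have "- gen c + a + gen c = nf_value ys"
    using nf_value_down[of xs c] c(1) xs(2) by (simp add: ys_def add.assoc del: add_uminus_conv_diff)
  moreover have "normal_form ys"
    unfolding ys_def using xs(1) by (rule normal_form_map) simp
  moreover have "x \<notin> snd ` set ys" if "x \<ge> s" for x
    using c(2) that by (fastforce simp: ys_def)
  ultimately show ?thesis
    by (metis coeff_nf(2))
qed

lemma conjugate_below_positive:
  fixes a b :: clifford
  assumes "0 < b"
  shows "\<exists>u. - u + a + u < b"
proof -
  obtain s where s: "coeff b s > 0" "\<forall>x>s. coeff b x = 0"
    using assms by (auto simp: zero_less_clifford_iff positive_iff_coeff)
  \<comment> \<open>Applied to \<open>- a\<close> because \<open>- u + a + u < b\<close> means that \<open>(- u + - a + u) + b\<close> is positive.\<close>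
  obtain u where u: "\<forall>x\<ge>s. coeff (- u + - a + u) x = 0"
    using conjugate_coeff_eventually_zero by blast
  have "positive ((- u + - a + u) + b)"
    unfolding positive_iff_coeff
    using coeff_add[where t = s and a = "- u + - a + u" and b = b] u s by (intro exI[of _ s]) auto
  moreover have "- (- u + a + u) = - u + - a + u"
    by (simp add: minus_add add.assoc del: add_uminus_conv_diff)
  ultimately show ?thesis
    unfolding less_clifford_def by metis
qed

theorem proposition40:
  fixes F :: "clifford set"
  assumes "final_segment {g. 0 < g} F"
    and "F \<noteq> {}"
    and "F \<noteq> {g. 0 < g}"
  shows "\<not> normal_subset F"
proof
  assume normal: "normal_subset F"
  obtain a where a: "a \<in> F" using assms(2) by blast
  have "b \<in> F" if pos: "0 < b" for b
  proof -
    obtain u where "- u + a + u < b"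
      using conjugate_below_positive[OF pos] by blast
    moreover have "- u + a + u \<in> F"
      using normal a by (simp add: normal_subset_def)
    ultimately show ?thesis
      using assms(1) pos unfolding final_segment_def by (metis less_imp_le mem_Collect_eq)
  qed
  then show False
    using assms(1,3) by (auto simp: final_segment_def)
qed

end
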